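(* Let $\lambda,\mu$ satisfy (A1)--(A4), let $n\in\mathbb N$, $\mathbf f\in L_2(\Omega)^d$ and $\tau>0$. Let $\mathbf T_{n,1,h}\in\mathbb M_{n,h}$ be the first component of the unique solution of the discrete problem (L$_{n,h}$), and let $\mathbf T_h^{(k)}\in\mathbb M_{n,h}$, $k=1,2,\dots$, be the successive iterates computed by the decoupled iterative algorithm (D) with parameter $\tau$. Then $$\lim_{k\to\infty}\|\mathbf T_h^{(k)}-\mathbf T_{n,1,h}\|_{L_2(\Omega)}=0.$$
   Context: $\Omega\subset\mathbb R^d$, $d\in\{2,3\}$, is a bounded polygonal domain ($d=2$) or bounded Lipschitz polyhedral domain ($d=3$). $\mathbb N=\{1,2,\dots\}$. The subscript "sym" denotes symmetric $d\times d$ tensors; $\mathbf S:\mathbf T=\sum_{i,j}S_{ij}T_{ij}$, $|\mathbf S|^2=\mathbf S:\mathbf S$; $\mathbf S^{\mathbf d}=\mathbf S-\frac1d\mathrm{Tr}(\mathbf S)\mathbf I$; $\varepsilon(\mathbf v)=\frac12(\nabla\mathbf v+(\nabla\mathbf v)^{\rm T})$. Assumptions on the material functions: $\lambda\in\mathcal C^0(\mathbb R)$, $\mu\in\mathcal C^0([0,\infty))$, $s\mapsto\lambda(s)s\in\mathcal C^1(\mathbb R)$, and there are positive constants $C_1,C_2,\kappa,\alpha$ such that (A1) $\frac{C_1s^2}{\kappa+|s|}\le\lambda(s)s^2\le C_2|s|$ for all $s\in\mathbb R$; (A2) $\frac{C_1s^2}{\kappa+s}\le\mu(s)s^2\le C_2s$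 for all $s\ge0$; (A3) $0\le\frac{d}{ds}(\lambda(s)s)$ for all $s\in\mathbb R$; (A4) $\frac{C_1}{(\kappa+s)^{\alpha+1}}\le\frac{d}{ds}(\mu(s)s)$ for all $s>0$. Finite element spaces $\mathbb M_{n,h}\subset L_2(\Omega)^{d\times d}_{\rm sym}$, $\mathbb X_{n,h}\subset H^1_0(\Omega)^d$, on a fixed subdivision $\mathcal T_h$ of $\overline\Omega$, either of the following: (i) on a conforming simplicial subdivision, $\mathbb M_{n,h}$ consists of the symmetric tensor fields constant on each $K\in\mathcal T_h$ and $\mathbb X_{n,h}$ of the continuous, elementwise affine $\mathbb R^d$-valued functions vanishing on $\partial\Omega$; (ii) on a conforming quadrilateral ($d=2$) or hexahedral ($d=3$) subdivision, $\mathbb M_{n,h}$ consists of the symmetric tensor fields, possibly discontinuous across elements, whose components are on each element mapped polynomials of degree $r\ge1$ in each variable, and $\mathbb X_{n,h}$ of the continuous $\mathbb R^d$-valued functions vanishing on $\partial\Omega$ whose components are of the same elementwise form. In both cases $\varepsilon(\mathbb X_{n,h})\subset\mathbb M_{n,h}$. For $\mathbf T_h,\mathbf S_h\in\mathbb M_{n,h}$ write $$N(\mathbf T_h,\mathbf S_h)=\int_\Omega\big(\lambda(\mathrm{Tr}(\mathbf T_h))\mathrm{Tr}(\mathbf T_h)\mathrm{Tr}(\mathbf S_h)+\mu(|\mathbf T_h^{\mathbf d}|)\mathbf T_h^{\mathbf d}:\mathbf S_h\big)\,dx.$$ Discrete problem (L$_{n,h}$): find $(\mathbf T_{n,1,h},\mathbf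 u_{n,1,h})\in\mathbb M_{n,h}\times\mathbb X_{n,h}$ with $$\frac1n\int_\Omega\mathbf T_{n,1,h}:\mathbf S_h\,dx+N(\mathbf T_{n,1,h},\mathbf S_h)-\int_\Omega\mathbf S_h:\varepsilon(\mathbf u_{n,1,h})\,dx=0\ \ \forall\,\mathbf S_h\in\mathbb M_{n,h},$$ $$\int_\Omega\mathbf T_{n,1,h}:\varepsilon(\mathbf v_h)\,dx=\int_\Omega\mathbf f\cdot\mathbf v_h\,dx\ \ \forall\,\mathbf v_h\in\mathbb X_{n,h}.$$ It has exactly one solution. Algorithm (D). Initialization: find $(\mathbf T_h^{(0)},\mathbf u_h^{(0)})\in\mathbb M_{n,h}\times\mathbb X_{n,h}$ with $\int_\Omega\varepsilon(\mathbf v_h):\mathbf T_h^{(0)}dx=\int_\Omega\mathbf f\cdot\mathbf v_h\,dx$ for all $\mathbf v_h\in\mathbb X_{n,h}$ and $\int_\Omega\mathbf T_h^{(0)}:\mathbf S_h\,dx=\int_\Omega\varepsilon(\mathbf u_h^{(0)}):\mathbf S_h\,dx$ for all $\mathbf S_h\in\mathbb M_{n,h}$. Given $(\mathbf T_h^{(k)},\mathbf u_h^{(k)})$, $k\ge0$: Step 1: find $\mathbf T_h^{(k+\frac12)}\in\mathbb M_{n,h}$ such that for all $\mathbf S_h\in\mathbb M_{n,h}$ $$\frac1\tau\int_\Omega(\mathbf T_h^{(k+\frac12)}-\mathbf T_h^{(k)}):\mathbf S_h\,dx+N(\mathbf T_h^{(k+\frac12)},\mathbf S_h)=\int_\Omega\varepsilon(\mathbf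 u_h^{(k)}):\mathbf S_h\,dx-\frac1n\int_\Omega\mathbf T_h^{(k)}:\mathbf S_h\,dx.$$ Step 2: find $(\mathbf T_h^{(k+1)},\mathbf u_h^{(k+1)})\in\mathbb M_{n,h}\times\mathbb X_{n,h}$ such that for all $\mathbf S_h\in\mathbb M_{n,h}$ $$\frac1\tau\int_\Omega(\mathbf T_h^{(k+1)}-\mathbf T_h^{(k+\frac12)}):\mathbf S_h\,dx+\frac1n\int_\Omega\mathbf T_h^{(k+1)}:\mathbf S_h\,dx=\int_\Omega\varepsilon(\mathbf u_h^{(k+1)}):\mathbf S_h\,dx-N(\mathbf T_h^{(k+\frac12)},\mathbf S_h),$$ and $\int_\Omega\varepsilon(\mathbf v_h):\mathbf T_h^{(k+1)}dx=\int_\Omega\mathbf f\cdot\mathbf v_h\,dx$ for all $\mathbf v_h\in\mathbb X_{n,h}$. *)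

theory Defs
  imports "HOL-Analysis.Analysis"
begin

type_synonym 'n vfield = "real^'n \<Rightarrow> real^'n"
type_synonym 'n tfield = "real^'n \<Rightarrow> real^'n^'n"


section \<open>Polyhedral domains\<close>

text \<open>
  Near each boundary point the set is, in suitable orthonormal coordinates with last axis \<open>e\<close>,
  the part of an open set \<open>U\<close> above a Lipschitz graph over the hyperplane orthogonal to \<open>e\<close>.
\<close>

definition lipschitz_boundary :: "(real^'n) set \<Rightarrow> bool" where
  "lipschitz_boundary \<Omega> \<longleftrightarrow>
     (\<forall>x\<in>frontier \<Omega>. \<exists>U e g L. open U \<and> x \<in> U \<and> norm e = 1 \<and>
        L-lipschitz_on UNIV (g :: real^'n \<Rightarrow> real) \<and>
        \<Omega> \<inter> U = {y \<in> U. y \<bullet> e > g (y - (y \<bullet> e) *\<^sub>R e)})"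

text \<open>
  The boundary is a finite union of closed line segments (in the plane) or convex
  polygons (in space); the Lipschitz condition is imposed in space only.
\<close>

definition polyhedral_domain :: "(real^'n) set \<Rightarrow> bool" where
  "polyhedral_domain \<Omega> \<longleftrightarrow>
     open \<Omega> \<and> connected \<Omega> \<and> bounded \<Omega> \<and> \<Omega> \<noteq> {} \<and>
     (\<exists>\<F>. finite \<F> \<and> (\<forall>P\<in>\<F>. polytope P \<and> aff_dim P = int CARD('n) - 1) \<and>
          frontier \<Omega> = \<Union>\<F>) \<and>
     (CARD('n) = 3 \<longrightarrow> lipschitz_boundary \<Omega>)"


section \<open>Tensors and function spaces\<close>

text \<open>
  The product \<open>S : T\<close> and the norm \<open>|S|\<close> of tensors are the inner product and norm of the
  type \<^typ>\<open>real^'n^'n\<close>.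
\<close>

definition dev :: "real^'n^'n \<Rightarrow> real^'n^'n" where
  "dev S = S - (trace S / real CARD('n)) *\<^sub>R mat 1"

text \<open>
  The gradient is taken pointwise. For the continuous, elementwise smooth functions it is applied
  to, this agrees almost everywhere with the weak gradient.
\<close>

definition sym_grad :: "(real^'n \<Rightarrow> real^'n) \<Rightarrow> real^'n \<Rightarrow> real^'n^'n" where
  "sym_grad v x = (1/2) *\<^sub>R (jacobian v (at x) + transpose (jacobian v (at x)))"

definition L2_fun :: "(real^'n) set \<Rightarrow> (real^'n \<Rightarrow> 'b::euclidean_space) \<Rightarrow> bool" where
  "L2_fun \<Omega> f \<longleftrightarrow> f \<in> borel_measurable (lebesgue_on \<Omega>) \<and>
                 integrable (lebesgue_on \<Omega>) (\<lambda>x. (norm (f x))\<^sup>2)"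

definition L2_inner ::
    "(real^'n) set \<Rightarrow> (real^'n \<Rightarrow> 'b::euclidean_space) \<Rightarrow> (real^'n \<Rightarrow> 'b) \<Rightarrow> real" where
  "L2_inner \<Omega> f g = (\<integral>x. f x \<bullet> g x \<partial>lebesgue_on \<Omega>)"

definition L2_nrm :: "(real^'n) set \<Rightarrow> (real^'n \<Rightarrow> 'b::euclidean_space) \<Rightarrow> real" where
  "L2_nrm \<Omega> f = sqrt (\<integral>x. (norm (f x))\<^sup>2 \<partial>lebesgue_on \<Omega>)"


section \<open>Material functions\<close>

text \<open>The values of \<open>\<mu>\<close> at negative arguments are irrelevant.\<close>

definition material_functions :: "(real \<Rightarrow> real) \<Rightarrow> (real \<Rightarrow> real) \<Rightarrow> bool" where
  "material_functions lam \<mu> \<longleftrightarrow>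
     continuous_on UNIV lam \<and> continuous_on {0..} \<mu> \<and>
     (\<lambda>s. lam s * s) C1_differentiable_on UNIV \<and>
     (\<exists>C1>0. \<exists>C2>0. \<exists>\<kappa>>0. \<exists>\<alpha>>0.
        (\<forall>s. C1 * s\<^sup>2 / (\<kappa> + \<bar>s\<bar>) \<le> lam s * s\<^sup>2 \<and> lam s * s\<^sup>2 \<le> C2 * \<bar>s\<bar>) \<and>
        (\<forall>s\<ge>0. C1 * s\<^sup>2 / (\<kappa> + s) \<le> \<mu> s * s\<^sup>2 \<and> \<mu> s * s\<^sup>2 \<le> C2 * s) \<and>
        (\<forall>s. 0 \<le> deriv (\<lambda>t. lam t * t) s) \<and>
        (\<forall>s>0. (\<lambda>t. \<mu> t * t) field_differentiable at s \<and>
               C1 / (\<kappa> + s) powr (\<alpha> + 1) \<le> deriv (\<lambda>t. \<mu> t * t) s))"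


section \<open>Finite element spaces\<close>

text \<open>
  Discontinuous fields are prescribed on the interiors of the elements only; their values on
  the skeleton, a null set, are arbitrary.
\<close>

definition simplicial_subdivision :: "(real^'n) set \<Rightarrow> (real^'n) set set \<Rightarrow> bool" where
  "simplicial_subdivision \<Omega> \<T> \<longleftrightarrow>
     triangulation \<T> \<and> (\<forall>K\<in>\<T>. int CARD('n) simplex K) \<and> \<Union>\<T> = closure \<Omega>"

definition M_simplicial :: "(real^'n) set set \<Rightarrow> 'n tfield set" where
  "M_simplicial \<T> = {T. \<forall>K\<in>\<T>. \<exists>C. transpose C = C \<and> (\<forall>x\<in>interior K. T x = C)}"

definition X_simplicial :: "(real^'n) set \<Rightarrow> (real^'n) set set \<Rightarrow> 'n vfield set" where
  "X_simplicial \<Omega> \<T> = {v. continuous_on (closure \<Omega>) v \<and> (\<forall>x\<in>frontier \<Omega>. v x = 0) \<and>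
     (\<forall>K\<in>\<T>. \<exists>A b. \<forall>x\<in>K. v x = A *v x + b)}"

text \<open>Polynomial functions of degree at most \<open>r\<close> in each variable.\<close>

definition Q_poly :: "nat \<Rightarrow> (real^'n \<Rightarrow> real) set" where
  "Q_poly r = {p. \<exists>c. \<forall>\<xi>. p \<xi> = (\<Sum>m | \<forall>i. m i \<le> r. c m * (\<Prod>i\<in>UNIV. \<xi> $ i ^ m i))}"

text \<open>
  \<open>F K\<close> is the multilinear map from the reference element, the unit cube \<^term>\<open>cbox 0 1\<close>,
  onto \<open>K\<close>. Elements need not be affine images of the cube. Conformity: two distinct elements
  meet in the image of a proper (possibly empty) face of the cube under both maps.
\<close>

definition hexahedral_subdivision ::
    "(real^'n) set \<Rightarrow> (real^'n) set set \<Rightarrow> ((real^'n) set \<Rightarrow> real^'n \<Rightarrow> real^'n) \<Rightarrow> bool" where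
  "hexahedral_subdivision \<Omega> \<T> F \<longleftrightarrow>
     finite \<T> \<and> \<Union>\<T> = closure \<Omega> \<and>
     (\<forall>K\<in>\<T>. (\<forall>i. (\<lambda>\<xi>. F K \<xi> $ i) \<in> Q_poly 1) \<and>
            inj_on (F K) (cbox 0 1) \<and>
            (\<forall>\<xi>\<in>cbox 0 1. det (jacobian (F K) (at \<xi>)) \<noteq> 0) \<and>
            F K ` cbox 0 1 = K) \<and>
     (\<forall>K\<in>\<T>. \<forall>K'\<in>\<T>. K \<noteq> K' \<longrightarrow>
        (\<exists>A B. A face_of cbox 0 1 \<and> A \<noteq> cbox 0 1 \<and> B face_of cbox 0 1 \<and> B \<noteq> cbox 0 1 \<and>
               K \<inter> K' = F K ` A \<and> K \<inter> K' = F K' ` B))"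

text \<open>
  A function on \<open>K\<close> is a mapped polynomial if its pullback along \<open>F K\<close> to the reference
  element is a polynomial.
\<close>

definition M_hexahedral ::
    "(real^'n) set set \<Rightarrow> ((real^'n) set \<Rightarrow> real^'n \<Rightarrow> real^'n) \<Rightarrow> nat \<Rightarrow> 'n tfield set" where
  "M_hexahedral \<T> F r = {T. \<forall>K\<in>\<T>.
     (\<forall>x\<in>interior K. transpose (T x) = T x) \<and>
     (\<forall>i j. \<exists>p\<in>Q_poly r. \<forall>\<xi>\<in>box 0 1. T (F K \<xi>) $ i $ j = p \<xi>)}"

definition X_hexahedral ::
    "(real^'n) set \<Rightarrow> (real^'n) set set \<Rightarrow> ((real^'n) set \<Rightarrow> real^'n \<Rightarrow> real^'n) \<Rightarrow> nat \<Rightarrow>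
     'n vfield set" where
  "X_hexahedral \<Omega> \<T> F r = {v. continuous_on (closure \<Omega>) v \<and> (\<forall>x\<in>frontier \<Omega>. v x = 0) \<and>
     (\<forall>K\<in>\<T>. \<forall>i. \<exists>p\<in>Q_poly r. \<forall>\<xi>\<in>cbox 0 1. v (F K \<xi>) $ i = p \<xi>)}"

definition fe_spaces :: "(real^'n) set \<Rightarrow> 'n tfield set \<Rightarrow> 'n vfield set \<Rightarrow> bool" where
  "fe_spaces \<Omega> M X \<longleftrightarrow>
     (\<exists>\<T>. simplicial_subdivision \<Omega> \<T> \<and> M = M_simplicial \<T> \<and> X = X_simplicial \<Omega> \<T>) \<or>
     (\<exists>\<T> F r. hexahedral_subdivision \<Omega> \<T> F \<and> r \<ge> 1 \<and>
        M = M_hexahedral \<T> F r \<and> X = X_hexahedral \<Omega> \<T> F r)"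


section \<open>The discrete problem and the decoupled iterative algorithm\<close>

definition N_form ::
    "(real^'n) set \<Rightarrow> (real \<Rightarrow> real) \<Rightarrow> (real \<Rightarrow> real) \<Rightarrow> 'n tfield \<Rightarrow> 'n tfield \<Rightarrow> real" where
  "N_form \<Omega> lam \<mu> T S =
     (\<integral>x. lam (trace (T x)) * trace (T x) * trace (S x)
          + \<mu> (norm (dev (T x))) * (dev (T x) \<bullet> S x) \<partial>lebesgue_on \<Omega>)"

definition discrete_solution ::
    "(real^'n) set \<Rightarrow> 'n tfield set \<Rightarrow> 'n vfield set \<Rightarrow> (real \<Rightarrow> real) \<Rightarrow> (real \<Rightarrow> real) \<Rightarrow>
     nat \<Rightarrow> 'n vfield \<Rightarrow> 'n tfield \<Rightarrow> 'n vfield \<Rightarrow> bool" where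
  "discrete_solution \<Omega> M X lam \<mu> n f T u \<longleftrightarrow>
     T \<in> M \<and> u \<in> X \<and>
     (\<forall>S\<in>M. 1 / real n * L2_inner \<Omega> T S + N_form \<Omega> lam \<mu> T S
            - L2_inner \<Omega> S (sym_grad u) = 0) \<and>
     (\<forall>v\<in>X. L2_inner \<Omega> T (sym_grad v) = L2_inner \<Omega> f v)"

text \<open>
  \<open>T k\<close>, \<open>u k\<close> are the iterates with index \<open>k\<close>, and \<open>Th k\<close> is the intermediate iterate with
  index \<open>k + 1/2\<close>.
\<close>

definition algorithm_D ::
    "(real^'n) set \<Rightarrow> 'n tfield set \<Rightarrow> 'n vfield set \<Rightarrow> (real \<Rightarrow> real) \<Rightarrow> (real \<Rightarrow> real) \<Rightarrow>
     nat \<Rightarrow> 'n vfield \<Rightarrow> real \<Rightarrow>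
     (nat \<Rightarrow> 'n tfield) \<Rightarrow> (nat \<Rightarrow> 'n tfield) \<Rightarrow> (nat \<Rightarrow> 'n vfield) \<Rightarrow> bool" where
  "algorithm_D \<Omega> M X lam \<mu> n f \<tau> T Th u \<longleftrightarrow>
     T 0 \<in> M \<and> u 0 \<in> X \<and>
     (\<forall>v\<in>X. L2_inner \<Omega> (sym_grad v) (T 0) = L2_inner \<Omega> f v) \<and>
     (\<forall>S\<in>M. L2_inner \<Omega> (T 0) S = L2_inner \<Omega> (sym_grad (u 0)) S) \<and>
     (\<forall>k.
        Th k \<in> M \<and>
        (\<forall>S\<in>M. 1 / \<tau> * L2_inner \<Omega> (\<lambda>x. Th k x - T k x) S + N_form \<Omega> lam \<mu> (Th k) S
               = L2_inner \<Omega> (sym_grad (u k)) S - 1 / real n * L2_inner \<Omega> (T k) S) \<and>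
        T (Suc k) \<in> M \<and> u (Suc k) \<in> X \<and>
        (\<forall>S\<in>M. 1 / \<tau> * L2_inner \<Omega> (\<lambda>x. T (Suc k) x - Th k x) S
                 + 1 / real n * L2_inner \<Omega> (T (Suc k)) S
               = L2_inner \<Omega> (sym_grad (u (Suc k))) S - N_form \<Omega> lam \<mu> (Th k) S) \<and>
        (\<forall>v\<in>X. L2_inner \<Omega> (sym_grad v) (T (Suc k)) = L2_inner \<Omega> f v))"

end

theory Submission
  imports Defs
begin

text \<open>
  Algorithm (D) is a Peaceman--Rachford splitting. Write \<open>e\<close>, \<open>h\<close>, \<open>g\<close> for the errors of
  \<open>T k\<close>, \<open>Th k\<close> and of the material response at \<open>Th k\<close>, and \<open>P\<close> for the
  \<open>L2\<close>-projection onto \<open>M\<close>. Reflecting \<open>z = P (2 e - h - \<tau> g)\<close> in \<open>e\<close> gives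
  \<open>2 e - z = P (h + \<tau> g)\<close>, and reflecting this in \<open>h\<close> gives the next value
  \<open>P (h - \<tau> g)\<close> of \<open>z\<close>. Since the strain error is orthogonal to \<open>e\<close>, the squared norm of
  \<open>z\<close> thereby drops by \<open>4 (\<tau> / n) \<parallel>e\<parallel>\<^sup>2 + 4 \<tau> (g, h)\<close>, where \<open>(g, h) \<ge> 0\<close> by monotonicity
  of the response. Hence the squared norms of the errors \<open>e\<close> are summable.
\<close>

section \<open>Square integrable fields\<close>

lemma L2_fun_integrable_inner:
  assumes "L2_fun \<Omega> F" "L2_fun \<Omega> H"
  shows "integrable (lebesgue_on \<Omega>) (\<lambda>x. F x \<bullet> H x)"
proof (rule Bochner_Integration.integrable_bound)
  show "integrable (lebesgue_on \<Omega>) (\<lambda>x. (norm (F x))\<^sup>2 + (norm (H x))\<^sup>2)"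
    using assms unfolding L2_fun_def by simp
  have [measurable]: "F \<in> borel_measurable (lebesgue_on \<Omega>)" "H \<in> borel_measurable (lebesgue_on \<Omega>)"
    using assms unfolding L2_fun_def by auto
  show "(\<lambda>x. F x \<bullet> H x) \<in> borel_measurable (lebesgue_on \<Omega>)"
    by measurable
  have "\<bar>F x \<bullet> H x\<bar> \<le> (norm (F x))\<^sup>2 + (norm (H x))\<^sup>2" for x
  proof -
    have "\<bar>F x \<bullet> H x\<bar> \<le> norm (F x) * norm (H x)" by (rule Cauchy_Schwarz_ineq2)
    also have "\<dots> \<le> (norm (F x))\<^sup>2 + (norm (H x))\<^sup>2"
      using sum_squares_bound[of "norm (F x)" "norm (H x)"]
        mult_nonneg_nonneg[OF norm_ge_zero norm_ge_zero, of "F x" "H x"] by linarith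
    finally show ?thesis .
  qed
  then show "AE x in lebesgue_on \<Omega>. norm (F x \<bullet> H x) \<le> norm ((norm (F x))\<^sup>2 + (norm (H x))\<^sup>2)"
    by simp
qed

lemma L2_fun_scaleR: "L2_fun \<Omega> F \<Longrightarrow> L2_fun \<Omega> (\<lambda>x. c *\<^sub>R F x)"
  unfolding L2_fun_def by (auto simp: power_mult_distrib)

lemma L2_fun_add:
  assumes "L2_fun \<Omega> F" "L2_fun \<Omega> H"
  shows "L2_fun \<Omega> (\<lambda>x. F x + H x)"
proof -
  have "integrable (lebesgue_on \<Omega>) (\<lambda>x. (norm (F x))\<^sup>2 + (norm (H x))\<^sup>2 + 2 * (F x \<bullet> H x))"
    using assms L2_fun_integrable_inner[OF assms] unfolding L2_fun_def by simp
  then show ?thesis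
    using assms unfolding L2_fun_def
    by (auto simp: power2_norm_eq_inner inner_simps inner_commute algebra_simps)
qed

lemma L2_fun_diff:
  assumes "L2_fun \<Omega> F" "L2_fun \<Omega> H"
  shows "L2_fun \<Omega> (\<lambda>x. F x - H x)"
  using L2_fun_add[OF assms(1) L2_fun_scaleR[OF assms(2), of "-1"]] by simp

lemma L2_inner_commute: "L2_inner \<Omega> F H = L2_inner \<Omega> H F"
  by (simp add: L2_inner_def inner_commute)

lemma L2_inner_scaleR_left: "L2_inner \<Omega> (\<lambda>x. c *\<^sub>R F x) H = c * L2_inner \<Omega> F H"
  by (simp add: L2_inner_def)

lemma L2_inner_scaleR_right: "L2_inner \<Omega> H (\<lambda>x. c *\<^sub>R F x) = c * L2_inner \<Omega> H F"
  by (simp add: L2_inner_def)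

lemma L2_inner_add_left:
  assumes "L2_fun \<Omega> F" "L2_fun \<Omega> G" "L2_fun \<Omega> H"
  shows "L2_inner \<Omega> (\<lambda>x. F x + G x) H = L2_inner \<Omega> F H + L2_inner \<Omega> G H"
  using assms by (simp add: L2_inner_def inner_add_left L2_fun_integrable_inner)

lemma L2_inner_diff_left:
  assumes "L2_fun \<Omega> F" "L2_fun \<Omega> G" "L2_fun \<Omega> H"
  shows "L2_inner \<Omega> (\<lambda>x. F x - G x) H = L2_inner \<Omega> F H - L2_inner \<Omega> G H"
  using assms by (simp add: L2_inner_def inner_diff_left L2_fun_integrable_inner)

lemma L2_inner_add_right:
  assumes "L2_fun \<Omega> F" "L2_fun \<Omega> G" "L2_fun \<Omega> H"
  shows "L2_inner \<Omega> H (\<lambda>x. F x + G x) = L2_inner \<Omega> H F + L2_inner \<Omega> H G"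
  using L2_inner_add_left[OF assms] by (simp add: L2_inner_commute)

lemma L2_inner_diff_right:
  assumes "L2_fun \<Omega> F" "L2_fun \<Omega> G" "L2_fun \<Omega> H"
  shows "L2_inner \<Omega> H (\<lambda>x. F x - G x) = L2_inner \<Omega> H F - L2_inner \<Omega> H G"
  using L2_inner_diff_left[OF assms] by (simp add: L2_inner_commute)

lemma L2_inner_self_nonneg: "L2_inner \<Omega> F F \<ge> 0"
  by (simp add: L2_inner_def integral_nonneg_AE)

lemma L2_nrm_eq: "L2_nrm \<Omega> F = sqrt (L2_inner \<Omega> F F)"
  by (simp add: L2_nrm_def L2_inner_def power2_norm_eq_inner)

lemmas L2_fun_intros = L2_fun_add L2_fun_diff L2_fun_scaleR
lemmas L2_inner_simps = L2_inner_add_left L2_inner_add_right L2_inner_diff_left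
  L2_inner_diff_right L2_inner_scaleR_left L2_inner_scaleR_right L2_fun_intros

section \<open>Peaceman--Rachford iteration\<close>

text \<open>Equations are assumed only after testing with fields of \<open>M\<close>, so
  \<open>g\<close> may lie outside \<open>M\<close>. \<open>step\<close> is what remains when the
  second half-step and the next first half-step are combined and the strain cancels;
  \<open>energy\<close> is the first half-step tested with the error \<open>e k\<close>, on which
  the strain error vanishes. The constant \<gamma> stands for the regularization 1/n.\<close>

lemma peaceman_rachford_tendsto:
  fixes M :: "(real^'n \<Rightarrow> 'b::euclidean_space) set"
    and e h g :: "nat \<Rightarrow> real^'n \<Rightarrow> 'b"
  assumes L2: "\<And>S. S \<in> M \<Longrightarrow> L2_fun \<Omega> S"
    and add: "\<And>S T. S \<in> M \<Longrightarrow> T \<in> M \<Longrightarrow> (\<lambda>x. S x + T x) \<in> M"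
    and scale: "\<And>S c. S \<in> M \<Longrightarrow> (\<lambda>x. c *\<^sub>R S x) \<in> M"
    and e: "\<And>k. e k \<in> M" and h: "\<And>k. h k \<in> M" and g: "\<And>k. L2_fun \<Omega> (g k)"
    and pos: "\<tau> > 0" "\<gamma> > 0"
    and step: "\<And>k S. S \<in> M \<Longrightarrow>
      L2_inner \<Omega> (h k) S - \<tau> * L2_inner \<Omega> (g k) S =
      2 * L2_inner \<Omega> (e (Suc k)) S - L2_inner \<Omega> (h (Suc k)) S - \<tau> * L2_inner \<Omega> (g (Suc k)) S"
    and energy: "\<And>k. L2_inner \<Omega> (h k) (e k) + \<tau> * L2_inner \<Omega> (g k) (e k) =
      (1 - \<tau> * \<gamma>) * L2_inner \<Omega> (e k) (e k)"
    and mono: "\<And>k. L2_inner \<Omega> (g k) (h k) \<ge> 0"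
  shows "(\<lambda>k. L2_nrm \<Omega> (e k)) \<longlonglongrightarrow> 0"
proof -
  txt \<open>
    The supremum of \<open>q k\<close> over \<open>M\<close> is the squared norm of the projection of \<open>2 e - h - \<tau> g\<close>.
    Bounding \<open>q k\<close> pointwise avoids constructing that projection.
  \<close>
  define q where "q k S = 2 * (2 * L2_inner \<Omega> (e k) S - L2_inner \<Omega> (h k) S
      - \<tau> * L2_inner \<Omega> (g k) S) - L2_inner \<Omega> S S" for k S
  note [simp] = L2[OF e] L2[OF h] g
  \<comment> \<open>The values z of the iteration satisfy z_k = z_(k+1) + 2 (e_k - h_k), so this
    shift carries the maximizer of \<open>q (Suc k)\<close> to that of \<open>q k\<close>. The term
    \<open>4 * \<tau> * L2_inner \<Omega> (g k) (h k)\<close> is dropped by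
    \<open>mono\<close>.\<close>
  have q_Suc: "q (Suc k) S + 4 * \<tau> * \<gamma> * L2_inner \<Omega> (e k) (e k)
      \<le> q k (\<lambda>x. S x + 2 *\<^sub>R (e k x - h k x))" if S: "S \<in> M" for k S
  proof -
    note [simp] = L2[OF S]
    have "L2_inner \<Omega> (e k) (h k) = L2_inner \<Omega> (h k) (e k)"
         "L2_inner \<Omega> S (h k) = L2_inner \<Omega> (h k) S" "L2_inner \<Omega> S (e k) = L2_inner \<Omega> (e k) S"
      by (simp_all add: L2_inner_commute)
    then have "q k (\<lambda>x. S x + 2 *\<^sub>R (e k x - h k x))
      = 2 * (L2_inner \<Omega> (h k) S - \<tau> * L2_inner \<Omega> (g k) S) - L2_inner \<Omega> S S
        + 4 * L2_inner \<Omega> (e k) (e k) - 4 * (L2_inner \<Omega> (h k) (e k) + \<tau> * L2_inner \<Omega> (g k) (e k))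
        + 4 * \<tau> * L2_inner \<Omega> (g k) (h k)"
      by (simp add: q_def L2_inner_simps algebra_simps)
    also have "\<dots> = q (Suc k) S + 4 * \<tau> * \<gamma> * L2_inner \<Omega> (e k) (e k)
        + 4 * \<tau> * L2_inner \<Omega> (g k) (h k)"
      unfolding energy step[OF S] q_def by (simp add: algebra_simps)
    finally show ?thesis using pos mono[of k] by simp
  qed
  \<comment> \<open>\<open>y\<close> is z_0 before projection onto \<open>M\<close>:
    \<open>q 0 S\<close> is 2 (y, S) - (S, S), and expanding the square of y - S bounds it by (y,
    y).\<close>
  define y where "y x = (2 *\<^sub>R e 0 x - h 0 x) - \<tau> *\<^sub>R g 0 x" for x
  have y: "L2_fun \<Omega> y" unfolding y_def by (simp add: L2_fun_intros)
  have q_le: "q k S + 4 * \<tau> * \<gamma> * (\<Sum>j<k. L2_inner \<Omega> (e j) (e j)) \<le> L2_inner \<Omega> y y"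
    if "S \<in> M" for k S
    using that
  \<comment> \<open>Each step back in k moves the test field by the shift above, so the claim has to
    range over all of \<open>M\<close>.\<close>
  proof (induction k arbitrary: S)
    case 0
    note [simp] = L2[OF 0]
    have yS: "L2_inner \<Omega> y S = 2 * L2_inner \<Omega> (e 0) S - L2_inner \<Omega> (h 0) S - \<tau> * L2_inner \<Omega> (g 0) S"
      unfolding y_def by (simp add: L2_inner_simps)
    have "0 \<le> L2_inner \<Omega> (\<lambda>x. y x - S x) (\<lambda>x. y x - S x)"
      by (rule L2_inner_self_nonneg)
    also have "\<dots> = L2_inner \<Omega> y y - 2 * L2_inner \<Omega> y S + L2_inner \<Omega> S S"
      using L2_inner_commute[of \<Omega> y S] y by (simp add: L2_inner_simps)
    finally show ?case by (simp add: q_def yS)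
  next
    case (Suc k)
    have "(\<lambda>x. S x + 2 *\<^sub>R (e k x + (-1) *\<^sub>R h k x)) \<in> M"
      by (intro add scale e h Suc.prems)
    then have "q k (\<lambda>x. S x + 2 *\<^sub>R (e k x - h k x))
      + 4 * \<tau> * \<gamma> * (\<Sum>j<k. L2_inner \<Omega> (e j) (e j)) \<le> L2_inner \<Omega> y y"
      using Suc.IH by simp
    with q_Suc[OF Suc.prems, of k] show ?case by (simp add: algebra_simps)
  qed
  \<comment> \<open>At the zero field \<open>q k\<close> vanishes for every k, so the bound falls on
    the partial sums alone.\<close>
  have "(\<lambda>x. 0) \<in> M" using scale[OF e[of 0], of 0] by simp
  moreover have "q k (\<lambda>x. 0) = 0" for k by (simp add: q_def L2_inner_def)
  ultimately have "4 * \<tau> * \<gamma> * (\<Sum>j<k. L2_inner \<Omega> (e j) (e j)) \<le> L2_inner \<Omega> y y" for k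
    using q_le[of "\<lambda>x. 0" k] by simp
  then have "(\<Sum>j<k. L2_inner \<Omega> (e j) (e j)) \<le> L2_inner \<Omega> y y / (4 * \<tau> * \<gamma>)" for k
    using pos by (simp add: pos_le_divide_eq mult.commute)
  then have "summable (\<lambda>j. L2_inner \<Omega> (e j) (e j))"
    by (intro summableI_nonneg_bounded L2_inner_self_nonneg)
  then have "(\<lambda>k. L2_inner \<Omega> (e k) (e k)) \<longlonglongrightarrow> 0"
    by (rule summable_LIMSEQ_zero)
  from tendsto_real_sqrt[OF this] show ?thesis by (simp add: L2_nrm_eq)
qed

section \<open>Finite element fields\<close>

lemma L2_fun_bounded:
  assumes \<Omega>: "\<Omega> \<in> lmeasurable" and meas: "F \<in> borel_measurable (lebesgue_on \<Omega>)"
    and bound: "AE x in lebesgue_on \<Omega>. norm (F x) \<le> B"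
  shows "L2_fun \<Omega> F"
proof -
  interpret finite_measure "lebesgue_on \<Omega>"
    using \<Omega> by (rule finite_measure_lebesgue_on)
  have "AE x in lebesgue_on \<Omega>. norm ((norm (F x))\<^sup>2) \<le> B\<^sup>2"
    using bound by eventually_elim (simp add: power_mono)
  then have "integrable (lebesgue_on \<Omega>) (\<lambda>x. (norm (F x))\<^sup>2)"
    by (rule integrable_const_bound) (use meas in measurable)
  with meas show ?thesis by (simp add: L2_fun_def)
qed

text \<open>\<open>Z\<close> plays the skeleton, where a field may take any values. Measurability
  survives there because every subset of a Lebesgue null set is Lebesgue measurable. The bound,
  common to the finitely many pieces, holds almost everywhere, which suffices on a domain of finite
  measure.\<close>

lemma L2_fun_piecewise_continuous:
  fixes F :: "real^'n \<Rightarrow> 'b::euclidean_space"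
  assumes \<Omega>: "\<Omega> \<in> lmeasurable" and fin: "finite \<U>" and neg: "negligible Z"
    and cover: "\<Omega> \<subseteq> Z \<union> \<Union>\<U>"
    and op: "\<And>U. U \<in> \<U> \<Longrightarrow> open U"
    and cont: "\<And>U. U \<in> \<U> \<Longrightarrow> continuous_on U F"
    and bdd: "\<And>U. U \<in> \<U> \<Longrightarrow> bounded (F ` U)"
  shows "L2_fun \<Omega> F"
proof -
  have \<Omega>_sets: "\<Omega> \<in> sets lebesgue" using \<Omega> by auto
  have Z_sets: "Y \<in> sets lebesgue" if "Y \<subseteq> Z" for Y
    using negligible_subset[OF neg that] by (rule negligible_imp_sets)
  obtain B where B: "\<And>U x. U \<in> \<U> \<Longrightarrow> x \<in> U \<Longrightarrow> norm (F x) \<le> B"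
  proof -
    have "bounded (\<Union>U\<in>\<U>. F ` U)" using fin bdd by auto
    then show thesis using that unfolding bounded_iff by (metis UN_I imageI)
  qed
  have "F \<in> borel_measurable (lebesgue_on \<Omega>)"
  proof (rule measurable_piecewise_restrict[where C = "insert Z \<U>"])
    show "countable (insert Z \<U>)" using fin by (simp add: countable_finite)
    show "space (lebesgue_on \<Omega>) \<subseteq> \<Union> (insert Z \<U>)" using cover by auto
    fix U assume U: "U \<in> insert Z \<U>"
    have U_sets: "U \<in> sets lebesgue" using U op[of U] Z_sets[of Z] by auto
    show "U \<inter> space (lebesgue_on \<Omega>) \<in> sets (lebesgue_on \<Omega>)"
      using U_sets \<Omega>_sets by (auto simp: sets_restrict_space)
    have eq: "restrict_space (lebesgue_on \<Omega>) U = lebesgue_on (\<Omega> \<inter> U)"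
      using \<Omega>_sets U_sets by (simp add: restrict_restrict_space)
    show "F \<in> borel_measurable (restrict_space (lebesgue_on \<Omega>) U)"
    proof (cases "U \<in> \<U>")
      case True
      then show ?thesis unfolding eq
        by (intro continuous_imp_measurable_on_sets_lebesgue)
          (use cont \<Omega>_sets U_sets in \<open>auto intro: continuous_on_subset\<close>)
    next
      case False
      with U have "U = Z" by simp
      have Z_subsets: "A \<in> sets (lebesgue_on (\<Omega> \<inter> Z))" if "A \<subseteq> \<Omega> \<inter> Z" for A
        using that Z_sets[of A] Z_sets[of "\<Omega> \<inter> Z"] by (auto simp: sets_restrict_space_iff)
      show ?thesis unfolding eq unfolding \<open>U = Z\<close>
        by (intro measurableI Z_subsets) auto
    qed
  qed
  moreover have "AE x in lebesgue. x \<notin> Z"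
    using neg by (simp add: AE_not_in negligible_iff_null_sets)
  then have "AE x in lebesgue. x \<in> \<Omega> \<longrightarrow> norm (F x) \<le> B"
    by (rule eventually_mono) (use cover B in blast)
  then have "AE x in lebesgue_on \<Omega>. norm (F x) \<le> B"
    using \<Omega>_sets by (simp add: AE_restrict_space_iff)
  ultimately show ?thesis using \<Omega> by (intro L2_fun_bounded)
qed

text \<open>The field is constant on each element interior. Its unprescribed values sit on the
  element frontiers, which are null because simplices are convex.\<close>

lemma M_simplicial_L2_fun:
  fixes \<Omega> :: "(real^'n) set"
  assumes \<Omega>: "open \<Omega>" "bounded \<Omega>" and sub: "simplicial_subdivision \<Omega> \<T>"
    and T: "T \<in> M_simplicial \<T>"
  shows "L2_fun \<Omega> T"
proof (rule L2_fun_piecewise_continuous[where \<U> = "interior ` \<T>" and Z = "\<Union>K\<in>\<T>. frontier K"])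
  have fin: "finite \<T>" using sub by (auto simp: simplicial_subdivision_def triangulation_def)
  have conv: "convex K \<and> closed K" if K: "K \<in> \<T>" for K
  proof -
    have "int CARD('n) simplex K" using sub K by (auto simp: simplicial_subdivision_def)
    then show ?thesis
      by (meson convex_simplex closed_simplex)
  qed
  show "\<Omega> \<in> lmeasurable" using \<Omega> by (simp add: lmeasurable_open)
  show "finite (interior ` \<T>)" using fin by simp
  show "negligible (\<Union>K\<in>\<T>. frontier K)"
    using fin conv by (intro negligible_Union) (auto intro: negligible_convex_frontier)
  have "\<Omega> \<subseteq> \<Union>\<T>" using sub closure_subset by (auto simp: simplicial_subdivision_def)
  then show "\<Omega> \<subseteq> (\<Union>K\<in>\<T>. frontier K) \<union> \<Union> (interior ` \<T>)"
    using conv by (fastforce simp: frontier_def)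
  fix U assume "U \<in> interior ` \<T>"
  then obtain K where K: "K \<in> \<T>" "U = interior K" by auto
  then obtain C where C: "\<And>x. x \<in> U \<Longrightarrow> T x = C"
    using T by (fastforce simp: M_simplicial_def)
  show "open U" using K by simp
  show "continuous_on U T" using C by (simp add: continuous_on_cong[OF refl C])
  have "T ` U \<subseteq> {C}" using C by auto
  then show "bounded (T ` U)" by (rule bounded_subset[rotated]) simp
qed

lemma M_simplicial_lincomb:
  assumes "S \<in> M_simplicial \<T>" "T \<in> M_simplicial \<T>"
  shows "(\<lambda>x. a *\<^sub>R S x + b *\<^sub>R T x) \<in> M_simplicial \<T>"
  unfolding M_simplicial_def
proof (intro CollectI ballI)
  fix K assume K: "K \<in> \<T>"
  obtain C where C: "transpose C = C" "\<And>x. x \<in> interior K \<Longrightarrow> S x = C"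
    using assms(1) K by (auto simp: M_simplicial_def)
  obtain D where D: "transpose D = D" "\<And>x. x \<in> interior K \<Longrightarrow> T x = D"
    using assms(2) K by (auto simp: M_simplicial_def)
  have "transpose (a *\<^sub>R C + b *\<^sub>R D) = a *\<^sub>R transpose C + b *\<^sub>R transpose D"
    by (simp add: transpose_def vec_eq_iff)
  then show "\<exists>C. transpose C = C \<and> (\<forall>x\<in>interior K. a *\<^sub>R S x + b *\<^sub>R T x = C)"
    using C D by (intro exI[of _ "a *\<^sub>R C + b *\<^sub>R D"]) simp
qed

section \<open>Mapped polynomials on quadrilateral and hexahedral elements\<close>

lemma Q_poly_lincomb:
  assumes "p \<in> Q_poly r" "p' \<in> Q_poly r"
  shows "(\<lambda>\<xi>. a * p \<xi> + b * p' \<xi>) \<in> Q_poly r"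
proof -
  obtain c where c: "\<And>\<xi>. p \<xi> = (\<Sum>m | \<forall>i. m i \<le> r. c m * (\<Prod>i\<in>UNIV. \<xi> $ i ^ m i))"
    using assms(1) by (auto simp: Q_poly_def)
  obtain c' where c': "\<And>\<xi>. p' \<xi> = (\<Sum>m | \<forall>i. m i \<le> r. c' m * (\<Prod>i\<in>UNIV. \<xi> $ i ^ m i))"
    using assms(2) by (auto simp: Q_poly_def)
  show ?thesis unfolding Q_poly_def c c'
    by (intro CollectI exI[of _ "\<lambda>m. a * c m + b * c' m"])
      (simp add: sum_distrib_left sum.distrib algebra_simps)
qed

lemma differentiable_power_vec_nth: "(\<lambda>\<xi>::real^'n. \<xi> $ i ^ k) differentiable (at x within S)"
  by (intro differentiable_power bounded_linear_imp_differentiable bounded_linear_vec_nth)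

text \<open>Besides continuity, differentiability of the element maps is wanted: it makes the images
  of the faces of the cube null sets.\<close>

lemma Q_poly_differentiable:
  fixes p :: "real^'n \<Rightarrow> real"
  assumes "p \<in> Q_poly r"
  shows "p differentiable (at x within S)"
proof -
  obtain c where c: "p = (\<lambda>\<xi>. \<Sum>m | \<forall>i. m i \<le> r. c m * (\<Prod>i\<in>UNIV. \<xi> $ i ^ m i))"
    using assms by (auto simp: Q_poly_def fun_eq_iff)
  have "(\<lambda>\<xi>::real^'n. \<Prod>i\<in>I. \<xi> $ i ^ m i) differentiable (at x within S)" for m I
    by (induction I rule: infinite_finite_induct)
      (auto intro!: differentiable_mult differentiable_power_vec_nth)
  \<comment> \<open>The admissible exponents are the functions from the index type into
    \<open>{..r}\<close>, a finite set.\<close>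
  moreover have "finite {m::'n \<Rightarrow> nat. \<forall>i. m i \<le> r}"
    using finite_PiE[of "UNIV::'n set" "\<lambda>_. {..r}"] by (simp add: PiE_def Pi_def)
  ultimately show ?thesis unfolding c
    by (intro differentiable_sum) (auto intro!: differentiable_mult)
qed

text \<open>The pieces are the images of the open cube, open by invariance of domain; the skeleton
  is the image of the cube's boundary under differentiable maps, hence null. An injective continuous
  map on the compact cube has a continuous inverse, so on each piece the field is a polynomial
  composed with a continuous map.\<close>

lemma M_hexahedral_L2_fun:
  fixes \<Omega> :: "(real^'n) set"
  assumes \<Omega>: "open \<Omega>" "bounded \<Omega>" and sub: "hexahedral_subdivision \<Omega> \<T> F"
    and T: "T \<in> M_hexahedral \<T> F r"
  shows "L2_fun \<Omega> T"
proof (rule L2_fun_piecewise_continuous[where \<U> = "(\<lambda>K. F K ` box 0 1) ` \<T>"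
      and Z = "\<Union>K\<in>\<T>. F K ` (cbox 0 1 - box 0 1)"])
  have fin: "finite \<T>" using sub by (auto simp: hexahedral_subdivision_def)
  have F: "\<And>i. (\<lambda>\<xi>. F K \<xi> $ i) \<in> Q_poly 1" "inj_on (F K) (cbox 0 1)" "F K ` cbox 0 1 = K"
    if "K \<in> \<T>" for K
    using sub that by (auto simp: hexahedral_subdivision_def)
  have F_diff: "F K differentiable_on S" if "K \<in> \<T>" for K S
    unfolding differentiable_on_def
  proof
    fix x
    show "F K differentiable (at x within S)"
      unfolding differentiable_componentwise_within[of "F K"]
      using Q_poly_differentiable[OF F(1)[OF that]]
      by (auto simp: Basis_vec_def inner_axis)
  qed
  show "\<Omega> \<in> lmeasurable" using \<Omega> by (simp add: lmeasurable_open)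
  show "finite ((\<lambda>K. F K ` box 0 1) ` \<T>)" using fin by simp
  show "negligible (\<Union>K\<in>\<T>. F K ` (cbox 0 1 - box 0 1))"
    using fin
    by (intro negligible_Union)
      (auto intro!: negligible_differentiable_image_negligible negligible_frontier_interval F_diff)
  have "\<Omega> \<subseteq> \<Union>\<T>" using sub closure_subset by (auto simp: hexahedral_subdivision_def)
  also have "\<dots> = (\<Union>K\<in>\<T>. F K ` cbox 0 1)" using F(3) by auto
  finally show "\<Omega> \<subseteq> (\<Union>K\<in>\<T>. F K ` (cbox 0 1 - box 0 1)) \<union> \<Union> ((\<lambda>K. F K ` box 0 1) ` \<T>)"
    by (simp add: UN_Un_distrib[symmetric] image_Un[symmetric] Un_absorb2 box_subset_cbox)
  fix U assume "U \<in> (\<lambda>K. F K ` box 0 1) ` \<T>"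
  then obtain K where K: "K \<in> \<T>" "U = F K ` box 0 1" by auto
  have F_cont: "continuous_on S (F K)" for S
    using F_diff[OF K(1)] by (rule differentiable_imp_continuous_on)
  show "open U" unfolding K(2)
    by (intro invariance_of_domain F_cont open_box inj_on_subset[OF F(2)[OF K(1)]] box_subset_cbox)
  obtain G where "homeomorphism (cbox 0 1) K (F K) G"
    using homeomorphism_compact[OF compact_cbox F_cont F(3)[OF K(1)] F(2)[OF K(1)]] by blast
  then have G: "continuous_on K G" "\<And>\<xi>. \<xi> \<in> cbox 0 1 \<Longrightarrow> G (F K \<xi>) = \<xi>"
    by (auto simp: homeomorphism_def)
  have "\<exists>p. p \<in> Q_poly r \<and> (\<forall>\<xi>\<in>box 0 1. T (F K \<xi>) $ i $ j = p \<xi>)" for i j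
    using T K(1) unfolding M_hexahedral_def by blast
  then obtain p where p: "\<And>i j. p i j \<in> Q_poly r"
      "\<And>i j \<xi>. \<xi> \<in> box 0 1 \<Longrightarrow> T (F K \<xi>) $ i $ j = p i j \<xi>"
    by metis
  define P where "P \<xi> = (\<chi> i j. p i j \<xi>)" for \<xi>
  have P_cont: "continuous_on S P" for S
    unfolding P_def using p(1)
    by (intro continuous_on_vec_lambda differentiable_imp_continuous_on)
      (auto simp: differentiable_on_def intro: Q_poly_differentiable)
  have TP: "T (F K \<xi>) = P \<xi>" if "\<xi> \<in> box 0 1" for \<xi>
    using p(2)[OF that] by (simp add: P_def vec_eq_iff)
  have "U \<subseteq> K" using F(3)[OF K(1)] K(2) box_subset_cbox by blast
  then have "continuous_on U (\<lambda>x. P (G x))"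
    by (intro continuous_on_compose2[OF P_cont continuous_on_subset[OF G(1)]]) auto
  moreover have "P (G x) = T x" if "x \<in> U" for x
    using that TP G(2) box_subset_cbox unfolding K(2) by fastforce
  ultimately show "continuous_on U T" by (rule continuous_on_eq)
  \<comment> \<open>The bound is taken from \<open>P\<close> on the closed cube, since
    \<open>T\<close> agrees with the pulled-back polynomial only over the open one.\<close>
  have "bounded (P ` cbox 0 1)"
    by (intro compact_imp_bounded compact_continuous_image P_cont compact_cbox)
  moreover have "T ` U \<subseteq> P ` cbox 0 1"
    using TP box_subset_cbox unfolding K(2) by fastforce
  ultimately show "bounded (T ` U)" by (rule bounded_subset)
qed

lemma M_hexahedral_lincomb:
  assumes "S \<in> M_hexahedral \<T> F r" "T \<in> M_hexahedral \<T> F r"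
  shows "(\<lambda>x. a *\<^sub>R S x + b *\<^sub>R T x) \<in> M_hexahedral \<T> F r"
  unfolding M_hexahedral_def
proof (intro CollectI ballI conjI allI)
  fix K x assume K: "K \<in> \<T>" and x: "x \<in> interior K"
  have "transpose (a *\<^sub>R S x + b *\<^sub>R T x) = a *\<^sub>R transpose (S x) + b *\<^sub>R transpose (T x)"
    by (simp add: transpose_def vec_eq_iff)
  then show "transpose (a *\<^sub>R S x + b *\<^sub>R T x) = a *\<^sub>R S x + b *\<^sub>R T x"
    using assms K x by (simp add: M_hexahedral_def)
next
  fix K i j assume K: "K \<in> \<T>"
  obtain p where p: "p \<in> Q_poly r" "\<And>\<xi>. \<xi> \<in> box 0 1 \<Longrightarrow> S (F K \<xi>) $ i $ j = p \<xi>"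
    using assms(1) K unfolding M_hexahedral_def by blast
  obtain p' where p': "p' \<in> Q_poly r" "\<And>\<xi>. \<xi> \<in> box 0 1 \<Longrightarrow> T (F K \<xi>) $ i $ j = p' \<xi>"
    using assms(2) K unfolding M_hexahedral_def by blast
  show "\<exists>p\<in>Q_poly r. \<forall>\<xi>\<in>box 0 1. (a *\<^sub>R S (F K \<xi>) + b *\<^sub>R T (F K \<xi>)) $ i $ j = p \<xi>"
    using p p' by (intro bexI[OF _ Q_poly_lincomb[OF p(1) p'(1), of a b]]) simp
qed

lemma fe_spaces_lincomb:
  assumes "fe_spaces \<Omega> M X" "S \<in> M" "T \<in> M"
  shows "(\<lambda>x. a *\<^sub>R S x + b *\<^sub>R T x) \<in> M"
  using assms M_simplicial_lincomb M_hexahedral_lincomb unfolding fe_spaces_def by blast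

lemma fe_spaces_L2_fun:
  assumes "open \<Omega>" "bounded \<Omega>" "fe_spaces \<Omega> M X" "S \<in> M"
  shows "L2_fun \<Omega> S"
  using assms M_simplicial_L2_fun M_hexahedral_L2_fun unfolding fe_spaces_def by blast

section \<open>The material response\<close>

lemma mat_1_inner: "mat 1 \<bullet> (S::real^'n^'n) = trace S"
  by (simp add: trace_def inner_vec_def mat_def if_distrib[of "\<lambda>x. x * _"] cong: if_cong)

lemma trace_scaleR: "trace (c *\<^sub>R (A::real^'n^'n)) = c * trace A"
  by (simp add: trace_def sum_distrib_left)

lemma trace_dev: "trace (dev (A::real^'n^'n)) = 0"
  by (simp add: dev_def trace_sub trace_scaleR trace_I)

text \<open>The multiple of the identity removed from \<open>B\<close> is orthogonal to the
  trace-free \<open>dev A\<close>. This lets monotonicity in the deviators be tested with full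
  tensors.\<close>

lemma dev_inner_dev: "dev A \<bullet> dev B = dev A \<bullet> B"
  using mat_1_inner[of "dev A"]
  by (simp add: dev_def[of B] inner_diff_right trace_dev inner_commute)

lemma continuous_on_trace: "continuous_on UNIV (trace :: real^'n^'n \<Rightarrow> real)"
  unfolding trace_def by (intro continuous_intros)

lemma continuous_on_dev: "continuous_on UNIV (dev :: real^'n^'n \<Rightarrow> real^'n^'n)"
  unfolding dev_def using continuous_on_trace by (intro continuous_intros) auto

text \<open>The tensor that represents the integrand of \<open>N_form\<close>: since I : S is the
  trace of S, \<open>N_form\<close> becomes an \<open>L2\<close> inner product with this field,
  which need not belong to the finite element space.\<close>

definition material_response ::
    "(real \<Rightarrow> real) \<Rightarrow> (real \<Rightarrow> real) \<Rightarrow> real^'n^'n \<Rightarrow> real^'n^'n" where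
  "material_response lam \<mu> A = (lam (trace A) * trace A) *\<^sub>R mat 1 + \<mu> (norm (dev A)) *\<^sub>R dev A"

lemma N_form_eq_L2_inner:
  "N_form \<Omega> lam \<mu> T S = L2_inner \<Omega> (\<lambda>x. material_response lam \<mu> (T x)) S"
  by (simp add: N_form_def L2_inner_def material_response_def inner_add_left mat_1_inner)

text \<open>With a = |A| and b = |B|, the pairing equals (\<mu>(a) a - \<mu>(b) b)(a - b) +
  (\<mu>(a) + \<mu>(b))(a b - A : B). The first term is nonnegative by monotonicity along rays, the
  second by Cauchy-Schwarz.\<close>

lemma radial_monotone:
  fixes A B :: "'a::real_inner"
  assumes nonneg: "\<And>s. s > 0 \<Longrightarrow> 0 \<le> \<mu> s"
    and mono: "\<And>s t. 0 \<le> s \<Longrightarrow> s \<le> t \<Longrightarrow> \<mu> s * s \<le> \<mu> t * (t::real)"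
  shows "0 \<le> (\<mu> (norm A) *\<^sub>R A - \<mu> (norm B) *\<^sub>R B) \<bullet> (A - B)"
proof -
  \<comment> \<open>No sign of \<open>\<mu> 0\<close> is assumed; if one tensor vanishes, the
    Cauchy-Schwarz defect is zero.\<close>
  have nn: "0 \<le> \<mu> (norm C) * (norm A * norm B - A \<bullet> B)" if "C = A \<or> C = B" for C
  proof (cases "C = 0")
    case True
    with that show ?thesis by auto
  next
    case False
    then show ?thesis using nonneg norm_cauchy_schwarz[of A B] by (intro mult_nonneg_nonneg) auto
  qed
  have "0 \<le> (\<mu> (norm A) * norm A - \<mu> (norm B) * norm B) * (norm A - norm B)"
    using mono[of "norm A" "norm B"] mono[of "norm B" "norm A"]
    by (cases "norm A \<le> norm B") (auto simp: zero_le_mult_iff)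
  also have "\<dots> \<le> (\<mu> (norm A) * norm A - \<mu> (norm B) * norm B) * (norm A - norm B)
      + \<mu> (norm A) * (norm A * norm B - A \<bullet> B) + \<mu> (norm B) * (norm A * norm B - A \<bullet> B)"
    using nn[of A] nn[of B] by simp
  also have "\<dots> = \<mu> (norm A) * (norm A * norm A) + \<mu> (norm B) * (norm B * norm B)
      - (\<mu> (norm A) + \<mu> (norm B)) * (A \<bullet> B)"
    by (simp add: algebra_simps)
  also have "\<dots> = (\<mu> (norm A) *\<^sub>R A - \<mu> (norm B) *\<^sub>R B) \<bullet> (A - B)"
    by (simp add: inner_diff_left inner_diff_right inner_commute norm_eq_sqrt_inner
        real_sqrt_mult_self algebra_simps)
  finally show ?thesis .
qed

section \<open>Sign, bounds and monotonicity drawn from the assumptions on the material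
  functions\<close>

context
  fixes lam \<mu> :: "real \<Rightarrow> real"
  assumes mf: "material_functions lam \<mu>"
begin

lemma material_constants:
  obtains C1 C2 \<kappa> \<alpha> where "C1 > 0" "C2 > 0" "\<kappa> > 0"
    "\<And>s. C1 * s\<^sup>2 / (\<kappa> + \<bar>s\<bar>) \<le> lam s * s\<^sup>2" "\<And>s. lam s * s\<^sup>2 \<le> C2 * \<bar>s\<bar>"
    "\<And>s. s \<ge> 0 \<Longrightarrow> C1 * s\<^sup>2 / (\<kappa> + s) \<le> \<mu> s * s\<^sup>2" "\<And>s. s \<ge> 0 \<Longrightarrow> \<mu> s * s\<^sup>2 \<le> C2 * s"
    "\<And>s. s > 0 \<Longrightarrow> (\<lambda>t. \<mu> t * t) field_differentiable at s"
    "\<And>s. s > 0 \<Longrightarrow> C1 / (\<kappa> + s) powr (\<alpha> + 1) \<le> deriv (\<lambda>t. \<mu> t * t) s"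
  using mf unfolding material_functions_def by (elim conjE exE) (rule that; blast)

lemma material_mu_nonneg:
  assumes "s > 0" shows "0 \<le> \<mu> s"
proof -
  obtain C1 C2 \<kappa> where C: "C1 > 0" "\<kappa> > 0" "\<And>s. s \<ge> 0 \<Longrightarrow> C1 * s\<^sup>2 / (\<kappa> + s) \<le> \<mu> s * s\<^sup>2"
    by (rule material_constants) blast
  have "0 \<le> C1 * s\<^sup>2 / (\<kappa> + s)" using C(1,2) assms by simp
  also have "\<dots> \<le> \<mu> s * s\<^sup>2" using C(3) assms by simp
  finally show ?thesis using assms by (simp add: zero_le_mult_iff)
qed

lemma material_lam_nonneg:
  assumes "s \<noteq> 0" shows "0 \<le> lam s"
proof -
  obtain C1 C2 \<kappa> where C: "C1 > 0" "\<kappa> > 0" "\<And>s. C1 * s\<^sup>2 / (\<kappa> + \<bar>s\<bar>) \<le> lam s * s\<^sup>2"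
    by (rule material_constants) blast
  have "0 \<le> C1 * s\<^sup>2 / (\<kappa> + \<bar>s\<bar>)" using C(1,2) by simp
  also have "\<dots> \<le> lam s * s\<^sup>2" by (rule C(3))
  finally show ?thesis using assms by (simp add: zero_le_mult_iff)
qed

text \<open>Dividing the upper growth bounds by |s| bounds both products by the upper constant,
  nonnegativity of the coefficients supplying the absolute values. At s = 0 both products are
  zero.\<close>

lemma material_bounded: "\<exists>C. (\<forall>s. \<bar>lam s * s\<bar> \<le> C) \<and> (\<forall>s\<ge>0. \<bar>\<mu> s * s\<bar> \<le> C)"
proof -
  obtain C1 C where C: "C > 0" "\<And>s. lam s * s\<^sup>2 \<le> C * \<bar>s\<bar>" "\<And>s. s \<ge> 0 \<Longrightarrow> \<mu> s * s\<^sup>2 \<le> C * s"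
    by (rule material_constants) blast
  have "\<bar>lam s * s\<bar> \<le> C" for s
  proof (cases "s = 0")
    case False
    have "lam s * \<bar>s\<bar> * \<bar>s\<bar> \<le> C * \<bar>s\<bar>" using C(2)[of s] by (simp add: power2_eq_square mult.assoc)
    with False material_lam_nonneg[OF False] show ?thesis by (simp add: abs_mult)
  qed (use C in simp)
  moreover have "\<bar>\<mu> s * s\<bar> \<le> C" if "s \<ge> 0" for s
  proof (cases "s = 0")
    case False
    with that have s: "s > 0" by simp
    have "\<mu> s * s * s \<le> C * s" using C(3)[OF that] by (simp add: power2_eq_square mult.assoc)
    with s material_mu_nonneg[OF s] show ?thesis by (simp add: abs_mult)
  qed (use C in simp)
  ultimately show ?thesis by blast
qed

lemma material_lam_mono:
  assumes "s \<le> t" shows "lam s * s \<le> lam t * t"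
proof (rule DERIV_nonneg_imp_nondecreasing[OF assms])
  fix x
  have "(\<lambda>s. lam s * s) differentiable (at x)"
    using mf by (auto simp: material_functions_def C1_differentiable_on_eq)
  then have "((\<lambda>s. lam s * s) has_real_derivative deriv (\<lambda>s. lam s * s) x) (at x)"
    by (simp add: DERIV_deriv_iff_real_differentiable)
  then show "\<exists>y. ((\<lambda>s. lam s * s) has_real_derivative y) (at x) \<and> 0 \<le> y"
    using mf unfolding material_functions_def by blast
qed

text \<open>The derivative is controlled only at positive arguments, so the left endpoint, possibly
  0, is reached by continuity.\<close>

lemma material_mu_mono:
  assumes "0 \<le> s" "s \<le> t" shows "\<mu> s * s \<le> \<mu> t * t"
proof (rule DERIV_nonneg_imp_increasing_open[OF assms(2)])
  have "continuous_on {0..} \<mu>" using mf by (simp add: material_functions_def)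
  then show "continuous_on {s..t} (\<lambda>s. \<mu> s * s)"
    using assms by (intro continuous_intros) (auto intro: continuous_on_subset)
  fix x assume x: "s < x" "x < t"
  with assms have x0: "x > 0" by simp
  obtain C1 C2 \<kappa> \<alpha> where C: "C1 > 0"
      "\<And>s. s > 0 \<Longrightarrow> (\<lambda>t. \<mu> t * t) field_differentiable at s"
      "\<And>s. s > 0 \<Longrightarrow> C1 / (\<kappa> + s) powr (\<alpha> + 1) \<le> deriv (\<lambda>t. \<mu> t * t) s"
    by (rule material_constants) blast
  have "0 \<le> C1 / (\<kappa> + x) powr (\<alpha> + 1)" using C(1) by simp
  also have "\<dots> \<le> deriv (\<lambda>t. \<mu> t * t) x" by (rule C(3)[OF x0])
  finally show "\<exists>y. ((\<lambda>t. \<mu> t * t) has_real_derivative y) (at x) \<and> 0 \<le> y"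
    using C(2)[OF x0] DERIV_deriv_iff_field_differentiable by blast
qed

text \<open>The pairing splits into a trace part, monotone because \<open>lam s * s\<close> is
  nondecreasing, and a deviatoric part covered by \<open>radial_monotone\<close>.\<close>

lemma material_response_monotone:
  "0 \<le> (material_response lam \<mu> A - material_response lam \<mu> B) \<bullet> (A - B)"
proof -
  let ?a = "trace A" and ?b = "trace B"
  have "0 \<le> (lam ?a * ?a - lam ?b * ?b) * (?a - ?b)"
    using material_lam_mono[of ?a ?b] material_lam_mono[of ?b ?a]
    by (cases "?a \<le> ?b") (auto simp: zero_le_mult_iff)
  moreover have "0 \<le> (\<mu> (norm (dev A)) *\<^sub>R dev A - \<mu> (norm (dev B)) *\<^sub>R dev B) \<bullet> (dev A - dev B)"
    using material_mu_nonneg material_mu_mono by (rule radial_monotone)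
  moreover have "(\<mu> (norm (dev A)) *\<^sub>R dev A - \<mu> (norm (dev B)) *\<^sub>R dev B) \<bullet> (dev A - dev B)
      = (\<mu> (norm (dev A)) *\<^sub>R dev A - \<mu> (norm (dev B)) *\<^sub>R dev B) \<bullet> (A - B)"
    by (simp add: inner_diff_left inner_diff_right dev_inner_dev)
  moreover have "(material_response lam \<mu> A - material_response lam \<mu> B) \<bullet> (A - B)
      = (lam ?a * ?a - lam ?b * ?b) * (?a - ?b)
        + (\<mu> (norm (dev A)) *\<^sub>R dev A - \<mu> (norm (dev B)) *\<^sub>R dev B) \<bullet> (A - B)"
    by (simp add: material_response_def inner_diff_left inner_diff_right inner_add_left
        mat_1_inner algebra_simps)
  ultimately show ?thesis by linarith
qed

lemma continuous_on_material_response: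
  "continuous_on UNIV (material_response lam \<mu> :: real^'n^'n \<Rightarrow> real^'n^'n)"
proof -
  have lam: "continuous_on UNIV lam" and \<mu>: "continuous_on {0..} \<mu>"
    using mf by (auto simp: material_functions_def)
  have "continuous_on UNIV (\<lambda>A::real^'n^'n. lam (trace A))"
    by (rule continuous_on_compose2[OF lam continuous_on_trace]) simp
  moreover have "continuous_on UNIV (\<lambda>A::real^'n^'n. \<mu> (norm (dev A)))"
    by (rule continuous_on_compose2[OF \<mu> continuous_on_norm[OF continuous_on_dev]]) auto
  ultimately show ?thesis unfolding material_response_def
    by (intro continuous_on_add continuous_on_scaleR continuous_on_mult continuous_on_const
        continuous_on_trace continuous_on_dev)
qed

lemma bounded_material_response:
  "bounded (range (material_response lam \<mu> :: real^'n^'n \<Rightarrow> real^'n^'n))"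
proof -
  obtain C where C: "\<And>s. \<bar>lam s * s\<bar> \<le> C" "\<And>s. s \<ge> 0 \<Longrightarrow> \<bar>\<mu> s * s\<bar> \<le> C"
    using material_bounded by blast
  have "norm (material_response lam \<mu> A) \<le> C * norm (mat 1 :: real^'n^'n) + C" for A :: "real^'n^'n"
  proof -
    have "norm ((lam (trace A) * trace A) *\<^sub>R (mat 1 :: real^'n^'n)) \<le> C * norm (mat 1 :: real^'n^'n)"
      using C(1) by (simp add: mult_right_mono)
    moreover have "norm (\<mu> (norm (dev A)) *\<^sub>R dev A) \<le> C"
      using C(2)[of "norm (dev A)"] by (simp add: abs_mult)
    ultimately show ?thesis unfolding material_response_def by (meson norm_triangle_mono)
  qed
  then show ?thesis by (auto simp: bounded_iff)
qed

end

text \<open>The response is continuous and bounded, so on a domain of finite measure the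
  measurability of \<open>T\<close> already gives square integrability.\<close>

lemma material_response_L2_fun:
  fixes T :: "real^'n \<Rightarrow> real^'n^'n"
  assumes mf: "material_functions lam \<mu>" and \<Omega>: "\<Omega> \<in> lmeasurable" and T: "L2_fun \<Omega> T"
  shows "L2_fun \<Omega> (\<lambda>x. material_response lam \<mu> (T x))"
proof -
  obtain B where "\<And>A :: real^'n^'n. norm (material_response lam \<mu> A) \<le> B"
    using bounded_material_response[OF mf] by (auto simp: bounded_iff)
  then show ?thesis
    using T by (intro L2_fun_bounded[OF \<Omega>]
        borel_measurable_continuous_on[OF continuous_on_material_response[OF mf]])
      (auto simp: L2_fun_def)
qed

section \<open>Convergence: the errors of the decoupled algorithm fit the abstract iteration\<close>

theorem theorem7p1:
  fixes \<Omega> :: "(real^'n) set"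
    and M :: "'n tfield set" and X :: "'n vfield set"
    and lam \<mu> :: "real \<Rightarrow> real" and n :: nat and f :: "'n vfield" and \<tau> :: real
    and T_sol :: "'n tfield" and u_sol :: "'n vfield"
    and T Th :: "nat \<Rightarrow> 'n tfield" and u :: "nat \<Rightarrow> 'n vfield"
  assumes "CARD('n) \<in> {2, 3}"
    and "polyhedral_domain \<Omega>"
    and "fe_spaces \<Omega> M X"
    and "material_functions lam \<mu>"
    and "n \<ge> 1"
    and "L2_fun \<Omega> f"
    and "\<tau> > 0"
    and "discrete_solution \<Omega> M X lam \<mu> n f T_sol u_sol"
    and "algorithm_D \<Omega> M X lam \<mu> n f \<tau> T Th u"
  shows "(\<lambda>k. L2_nrm \<Omega> (\<lambda>x. T k x - T_sol x)) \<longlonglongrightarrow> 0"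
proof -
  let ?G = "\<lambda>T x. material_response lam \<mu> (T x)"
  let ?ip = "L2_inner \<Omega>"
  have \<Omega>: "open \<Omega>" "bounded \<Omega>" using assms(2) by (auto simp: polyhedral_domain_def)
  then have lm: "\<Omega> \<in> lmeasurable" by (simp add: lmeasurable_open)
  note fe = assms(3) and mf = assms(4) and \<tau> = assms(7)
  have n: "1 / real n > 0" using assms(5) by simp
  have L2: "L2_fun \<Omega> S" if "S \<in> M" for S using fe_spaces_L2_fun[OF \<Omega> fe that] .
  have GL2: "L2_fun \<Omega> (?G S)" if "S \<in> M" for S
    using material_response_L2_fun[OF mf lm L2[OF that]] .
  have M_add: "(\<lambda>x. S x + S' x) \<in> M" if "S \<in> M" "S' \<in> M" for S S'
    using fe_spaces_lincomb[OF fe that, of 1 1] by simp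
  have M_diff: "(\<lambda>x. S x - S' x) \<in> M" if "S \<in> M" "S' \<in> M" for S S'
    using fe_spaces_lincomb[OF fe that, of 1 "-1"] by simp
  have M_scale: "(\<lambda>x. c *\<^sub>R S x) \<in> M" if "S \<in> M" for S c
    using fe_spaces_lincomb[OF fe that that, of c 0] by simp
  have Ts: "T_sol \<in> M" and us: "u_sol \<in> X"
    and sol1: "\<And>S. S \<in> M \<Longrightarrow> ?ip (sym_grad u_sol) S = 1 / real n * ?ip T_sol S + ?ip (?G T_sol) S"
    and sol2: "\<And>v. v \<in> X \<Longrightarrow> ?ip (sym_grad v) T_sol = ?ip f v"
    using assms(8) unfolding discrete_solution_def N_form_eq_L2_inner
    by (auto simp: L2_inner_commute[of _ "sym_grad _"])
  \<comment> \<open>Index 0 comes from the initialization, each later index from step 2.\<close>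
  have TM: "T k \<in> M" and ThM: "Th k \<in> M" and uX: "u k \<in> X" for k
    using assms(9) unfolding algorithm_D_def by (cases k; blast)+
  note [simp] = L2[OF Ts] L2[OF TM] L2[OF ThM] GL2[OF Ts] GL2[OF TM] GL2[OF ThM] L2_fun_intros
  have constr: "?ip (sym_grad v) (T k) = ?ip f v" if "v \<in> X" for v k
    using assms(9) that unfolding algorithm_D_def by (cases k) auto
  have step1: "?ip (Th k) S - ?ip (T k) S + \<tau> * ?ip (?G (Th k)) S
      = \<tau> * (?ip (sym_grad (u k)) S - 1 / real n * ?ip (T k) S)" if "S \<in> M" for k S
  proof -
    have "1 / \<tau> * ?ip (\<lambda>x. Th k x - T k x) S + ?ip (?G (Th k)) S
        = ?ip (sym_grad (u k)) S - 1 / real n * ?ip (T k) S"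
      using assms(9) that unfolding algorithm_D_def N_form_eq_L2_inner by blast
    then show ?thesis using \<tau> L2[OF that] by (simp add: L2_inner_simps field_simps)
  qed
  have step2: "?ip (T (Suc k)) S - ?ip (Th k) S + \<tau> / real n * ?ip (T (Suc k)) S
      = \<tau> * (?ip (sym_grad (u (Suc k))) S - ?ip (?G (Th k)) S)" if "S \<in> M" for k S
  proof -
    have "1 / \<tau> * ?ip (\<lambda>x. T (Suc k) x - Th k x) S + 1 / real n * ?ip (T (Suc k)) S
        = ?ip (sym_grad (u (Suc k))) S - ?ip (?G (Th k)) S"
      using assms(9) that unfolding algorithm_D_def N_form_eq_L2_inner by blast
    then show ?thesis using \<tau> L2[OF that] by (simp add: L2_inner_simps field_simps)
  qed
  txt \<open>
    The functional given by the strain of \<open>u k\<close> is represented on \<open>M\<close> by a square integrable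
    field read off step 1, so no integrability of the strain itself is involved.
  \<close>
  have orth: "?ip (sym_grad (u k)) (\<lambda>x. T k x - T_sol x) = 0" for k
  proof -
    define H where "H x = ((1 / \<tau>) *\<^sub>R (Th k x - T k x) + ?G (Th k) x) + (1 / real n) *\<^sub>R T k x" for x
    have H: "L2_fun \<Omega> H" unfolding H_def by simp
    have rep: "?ip (sym_grad (u k)) S = ?ip H S" if "S \<in> M" for S
      using step1[OF that, of k] \<tau> L2[OF that] unfolding H_def
      by (simp add: L2_inner_simps field_simps)
    show ?thesis
      using constr[OF uX, of k k] sol2[OF uX, of k] H
      by (simp add: rep M_diff TM Ts L2_inner_simps)
  qed
  \<comment> \<open>Here the first discrete equation represents the strain functional of
    \<open>u_sol\<close> on \<open>M\<close> and so makes it additive; \<open>T k\<close> and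
    \<open>T_sol\<close> satisfy the same balance of forces.\<close>
  have orth_sol: "?ip (sym_grad u_sol) (\<lambda>x. T k x - T_sol x) = 0" for k
    using constr[OF us, of k] sol2[OF us] sol1[OF TM, of k] sol1[OF Ts] sol1[OF M_diff[OF TM Ts], of k]
    by (simp add: L2_inner_simps algebra_simps)
  show ?thesis
  proof (rule peaceman_rachford_tendsto[where \<tau> = \<tau> and \<gamma> = "1 / real n" and M = M
        and h = "\<lambda>k x. Th k x - T_sol x" and g = "\<lambda>k x. ?G (Th k) x - ?G T_sol x"])
    fix k S assume S: "S \<in> M"
    note [simp] = L2[OF S]
    show "?ip (\<lambda>x. Th k x - T_sol x) S - \<tau> * ?ip (\<lambda>x. ?G (Th k) x - ?G T_sol x) S
      = 2 * ?ip (\<lambda>x. T (Suc k) x - T_sol x) S - ?ip (\<lambda>x. Th (Suc k) x - T_sol x) S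
        - \<tau> * ?ip (\<lambda>x. ?G (Th (Suc k)) x - ?G T_sol x) S"
      \<comment> \<open>Step 2 at k and step 1 at k + 1 share the strain of \<open>u (Suc k)\<close>
        and the 1/n term at \<open>T (Suc k)\<close>; subtraction removes both. The contributions of
        \<open>T_sol\<close> agree on the two sides.\<close>
      using step2[OF S, of k] step1[OF S, of "Suc k"]
      by (simp add: L2_inner_simps algebra_simps)
  next
    fix k
    let ?e = "\<lambda>x. T k x - T_sol x"
    have e: "?e \<in> M" using TM Ts by (rule M_diff)
    note [simp] = L2[OF e]
    have "?ip (\<lambda>x. Th k x - T_sol x) ?e + \<tau> * ?ip (\<lambda>x. ?G (Th k) x - ?G T_sol x) ?e
      = (?ip (Th k) ?e - ?ip T_sol ?e) + \<tau> * (?ip (?G (Th k)) ?e - ?ip (?G T_sol) ?e)"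
      by (simp only: L2_inner_diff_left L2[OF e] L2[OF Ts] L2[OF ThM] GL2[OF Ts] GL2[OF ThM])
    also have "\<dots> = (1 - \<tau> * (1 / real n)) * (?ip (T k) ?e - ?ip T_sol ?e)"
      \<comment> \<open>Step 1 minus \<tau> times the equation of \<open>T_sol\<close>, tested with
        the error: both strain functionals vanish on it.\<close>
      using step1[OF e, of k] arg_cong[OF sol1[OF e], of "(*) \<tau>"] unfolding orth orth_sol
      by (simp add: algebra_simps)
    also have "?ip (T k) ?e - ?ip T_sol ?e = ?ip ?e ?e"
      by (simp only: L2_inner_diff_left L2[OF e] L2[OF Ts] L2[OF TM])
    finally show "?ip (\<lambda>x. Th k x - T_sol x) ?e + \<tau> * ?ip (\<lambda>x. ?G (Th k) x - ?G T_sol x) ?e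
      = (1 - \<tau> * (1 / real n)) * ?ip ?e ?e" .
  next
    fix k
    show "0 \<le> ?ip (\<lambda>x. ?G (Th k) x - ?G T_sol x) (\<lambda>x. Th k x - T_sol x)"
      unfolding L2_inner_def
      by (intro integral_nonneg_AE AE_I2 material_response_monotone[OF mf])
  qed (use L2 M_add M_scale M_diff TM ThM Ts \<tau> n in auto)
qed

end
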